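(* Every quotient of an $\mathscr{LP}$ space by a separably injective space is an $\mathscr{LP}$ space; that is, if $0\to S\to E\to Q\to 0$ is an exact sequence of Banach spaces in which $E$ is an $\mathscr{LP}$ space and $S$ is separably injective, then $Q$ is an $\mathscr{LP}$ space.
   Context: An exact sequence of Banach spaces is a diagram of Banach spaces and bounded linear operators in which the kernel of each operator equals the image of the preceding one. A Banach space $E$ is an $\mathscr{LP}$ (Lindenstrauss–Pełczyński) space if every bounded linear operator from a closed subspace of $c_0$ into $E$ can be extended to a bounded linear operator $c_0\to E$. A Banach space $S$ is separably injective if for every separable Banach space $X$ and every closed subspace $Y\subset X$, every bounded linear operator $Y\to S$ extends to a bounded linear operator $X\to S$. *)

theory Defs
  imports "HOL-Analysis.Analysis"
begin

text \<open>
  Scalars are real throughout.  Banach spaces occurring in a statement with an outermost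
  universal quantifier are types of class \<^class>\<open>banach\<close>.  Separable injectivity, however,
  quantifies over all separable Banach spaces inside a hypothesis, where no quantification over
  types is possible.  Test spaces are therefore given by explicit structures on a subset of
  some ambient type.
\<close>

record 'x normed_structure =
  points :: "'x set"
  vadd :: "'x \<Rightarrow> 'x \<Rightarrow> 'x"
  vzero :: 'x
  vscale :: "real \<Rightarrow> 'x \<Rightarrow> 'x"
  vnorm :: "'x \<Rightarrow> real"

text \<open>
  The value 0 off the carrier is forced by the locale \<^locale>\<open>Metric_space\<close>, which asks for
  nonnegativity and symmetry of the distance on the whole type.
\<close>

definition ndist :: "'x normed_structure \<Rightarrow> 'x \<Rightarrow> 'x \<Rightarrow> real" where
  "ndist X x y =
    (if x \<in> points X \<and> y \<in> points X then vnorm X (vadd X x (vscale X (-1) y)) else 0)"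

definition normed_topology :: "'x normed_structure \<Rightarrow> 'x topology" where
  "normed_topology X = Metric_space.mtopology (points X) (ndist X)"

definition is_normed_space :: "'x normed_structure \<Rightarrow> bool" where
  "is_normed_space X \<longleftrightarrow>
     vzero X \<in> points X \<and>
     (\<forall>x\<in>points X. \<forall>y\<in>points X. vadd X x y \<in> points X) \<and>
     (\<forall>c. \<forall>x\<in>points X. vscale X c x \<in> points X) \<and>
     (\<forall>x\<in>points X. \<forall>y\<in>points X. \<forall>z\<in>points X.
        vadd X (vadd X x y) z = vadd X x (vadd X y z)) \<and>
     (\<forall>x\<in>points X. \<forall>y\<in>points X. vadd X x y = vadd X y x) \<and>
     (\<forall>x\<in>points X. vadd X (vzero X) x = x) \<and>
     (\<forall>x\<in>points X. vadd X x (vscale X (-1) x) = vzero X) \<and>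
     (\<forall>c. \<forall>x\<in>points X. \<forall>y\<in>points X.
        vscale X c (vadd X x y) = vadd X (vscale X c x) (vscale X c y)) \<and>
     (\<forall>c d. \<forall>x\<in>points X.
        vscale X (c + d) x = vadd X (vscale X c x) (vscale X d x)) \<and>
     (\<forall>c d. \<forall>x\<in>points X. vscale X c (vscale X d x) = vscale X (c * d) x) \<and>
     (\<forall>x\<in>points X. vscale X 1 x = x) \<and>
     (\<forall>x\<in>points X. 0 \<le> vnorm X x) \<and>
     (\<forall>x\<in>points X. vnorm X x = 0 \<longleftrightarrow> x = vzero X) \<and>
     (\<forall>c. \<forall>x\<in>points X. vnorm X (vscale X c x) = \<bar>c\<bar> * vnorm X x) \<and>
     (\<forall>x\<in>points X. \<forall>y\<in>points X. vnorm X (vadd X x y) \<le> vnorm X x + vnorm X y)"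

definition is_banach_space :: "'x normed_structure \<Rightarrow> bool" where
  "is_banach_space X \<longleftrightarrow>
     is_normed_space X \<and> Metric_space.mcomplete (points X) (ndist X)"

definition closed_subspace :: "'x normed_structure \<Rightarrow> 'x set \<Rightarrow> bool" where
  "closed_subspace X Y \<longleftrightarrow>
     vzero X \<in> Y \<and>
     (\<forall>x\<in>Y. \<forall>y\<in>Y. vadd X x y \<in> Y) \<and>
     (\<forall>c. \<forall>x\<in>Y. vscale X c x \<in> Y) \<and>
     closedin (normed_topology X) Y"

text \<open>
  An operator on a subspace \<open>Y\<close> is a total function of which only the values on \<open>Y\<close> matter.
\<close>

definition bounded_operator_on ::
    "'x normed_structure \<Rightarrow> 'x set \<Rightarrow> ('x \<Rightarrow> 'e::real_normed_vector) \<Rightarrow> bool" where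
  "bounded_operator_on X Y T \<longleftrightarrow>
     (\<forall>x\<in>Y. \<forall>y\<in>Y. T (vadd X x y) = T x + T y) \<and>
     (\<forall>c. \<forall>x\<in>Y. T (vscale X c x) = c *\<^sub>R T x) \<and>
     (\<exists>K. \<forall>x\<in>Y. norm (T x) \<le> K * vnorm X x)"

definition operators_extend :: "'x normed_structure \<Rightarrow> 'e::banach itself \<Rightarrow> bool" where
  "operators_extend X TE \<longleftrightarrow>
     (\<forall>Y (T :: 'x \<Rightarrow> 'e). closed_subspace X Y \<and> bounded_operator_on X Y T \<longrightarrow>
        (\<exists>T' :: 'x \<Rightarrow> 'e. bounded_operator_on X (points X) T' \<and> (\<forall>y\<in>Y. T' y = T y)))"

definition class_structure :: "'x::real_normed_vector set \<Rightarrow> 'x normed_structure" where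
  "class_structure V =
     \<lparr>points = V, vadd = (+), vzero = 0, vscale = (*\<^sub>R), vnorm = norm\<rparr>"

text \<open>
  Since every function on \<^typ>\<open>nat\<close> is continuous, \<^typ>\<open>nat \<Rightarrow>\<^sub>C real\<close> is the space of all
  bounded real sequences with the supremum norm.
\<close>

definition c0 :: "(nat \<Rightarrow>\<^sub>C real) normed_structure" where
  "c0 = class_structure {x. apply_bcontfun x \<longlonglongrightarrow> 0}"

definition LP_space :: "'e::banach itself \<Rightarrow> bool" where
  "LP_space TE \<longleftrightarrow> operators_extend c0 TE"

text \<open>
  A separable metric space has at most continuum many points, so every separable Banach space
  is a structure on a subset of \<^typ>\<open>nat \<Rightarrow> real\<close>, up to renaming of points.  The lemma
  \<open>separably_injective_extend\<close> at the end shows that the choice of this ambient type is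
  immaterial.
\<close>

definition separably_injective :: "'s::banach itself \<Rightarrow> bool" where
  "separably_injective TS \<longleftrightarrow>
     (\<forall>X :: (nat \<Rightarrow> real) normed_structure.
        is_banach_space X \<and> separable_space (normed_topology X) \<longrightarrow> operators_extend X TS)"

text \<open>
  Exactness of \<open>0 \<rightarrow> S \<rightarrow> E \<rightarrow> Q \<rightarrow> 0\<close> at \<open>S\<close>, at \<open>E\<close> and at \<open>Q\<close>: \<open>{0}\<close> is the image
  of \<open>0 \<rightarrow> S\<close>, and \<^term>\<open>UNIV\<close> is the kernel of \<open>Q \<rightarrow> 0\<close>.
\<close>

definition short_exact_sequence :: "('s::banach \<Rightarrow> 'e::banach) \<Rightarrow> ('e \<Rightarrow> 'q::banach) \<Rightarrow> bool" where
  "short_exact_sequence i q \<longleftrightarrow>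
     bounded_linear i \<and> bounded_linear q \<and>
     {s. i s = 0} = {0} \<and> {e. q e = 0} = range i \<and> UNIV = range q"


lemma is_normed_spaceD:
  assumes "is_normed_space X"
  shows "vzero X \<in> points X"
    and "x \<in> points X \<Longrightarrow> y \<in> points X \<Longrightarrow> vadd X x y \<in> points X"
    and "x \<in> points X \<Longrightarrow> vscale X c x \<in> points X"
    and "x \<in> points X \<Longrightarrow> y \<in> points X \<Longrightarrow> z \<in> points X \<Longrightarrow>
      vadd X (vadd X x y) z = vadd X x (vadd X y z)"
    and "x \<in> points X \<Longrightarrow> y \<in> points X \<Longrightarrow> vadd X x y = vadd X y x"
    and "x \<in> points X \<Longrightarrow> vadd X (vzero X) x = x"
    and "x \<in> points X \<Longrightarrow> vadd X x (vscale X (-1) x) = vzero X"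
    and "x \<in> points X \<Longrightarrow> y \<in> points X \<Longrightarrow>
      vscale X c (vadd X x y) = vadd X (vscale X c x) (vscale X c y)"
    and "x \<in> points X \<Longrightarrow> vscale X (c + d) x = vadd X (vscale X c x) (vscale X d x)"
    and "x \<in> points X \<Longrightarrow> vscale X c (vscale X d x) = vscale X (c * d) x"
    and "x \<in> points X \<Longrightarrow> vscale X 1 x = x"
    and "x \<in> points X \<Longrightarrow> 0 \<le> vnorm X x"
    and "x \<in> points X \<Longrightarrow> vnorm X x = 0 \<longleftrightarrow> x = vzero X"
    and "x \<in> points X \<Longrightarrow> vnorm X (vscale X c x) = \<bar>c\<bar> * vnorm X x"
    and "x \<in> points X \<Longrightarrow> y \<in> points X \<Longrightarrow> vnorm X (vadd X x y) \<le> vnorm X x + vnorm X y"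
  using assms unfolding is_normed_space_def by (elim conjE, metis)+

lemma is_normed_space_Metric_space:
  assumes "is_normed_space X"
  shows "Metric_space (points X) (ndist X)"
proof
  note N = is_normed_spaceD[OF assms]
  fix x y
  show "0 \<le> ndist X x y"
    by (auto simp: ndist_def intro!: N)
  show "ndist X x y = ndist X y x"
  proof (cases "x \<in> points X \<and> y \<in> points X")
    case True
    then have m: "vscale X (-1) x \<in> points X" "vscale X (-1) y \<in> points X"
      by (auto intro: N)
    have "vscale X (-1) (vadd X x (vscale X (-1) y)) = vadd X (vscale X (-1) x) y"
      using True m by (simp add: N(8,10,11))
    also have "\<dots> = vadd X y (vscale X (-1) x)"
      using True m by (intro N(5)) auto
    finally have "vscale X (-1) (vadd X x (vscale X (-1) y)) = vadd X y (vscale X (-1) x)" .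
    moreover have "vnorm X (vscale X (-1) (vadd X x (vscale X (-1) y))) =
        vnorm X (vadd X x (vscale X (-1) y))"
      using True m by (simp add: N(2,14))
    ultimately show ?thesis using True by (simp add: ndist_def)
  qed (auto simp: ndist_def)
next
  note N = is_normed_spaceD[OF assms]
  fix x y assume xy: "x \<in> points X" "y \<in> points X"
  then have m: "vscale X (-1) y \<in> points X" by (intro N)
  have z: "vadd X (vscale X (-1) y) y = vzero X"
    using N(5)[OF m xy(2)] N(7)[OF xy(2)] by simp
  have "x = y" if "vadd X x (vscale X (-1) y) = vzero X"
  proof -
    have "x = vadd X x (vzero X)"
      using N(5)[OF xy(1) N(1)] N(6)[OF xy(1)] by simp
    also have "\<dots> = vadd X (vadd X x (vscale X (-1) y)) y"
      using N(4)[OF xy(1) m xy(2)] z by simp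
    also have "\<dots> = y" using that N(6)[OF xy(2)] by simp
    finally show ?thesis .
  qed
  then show "(ndist X x y = 0) = (x = y)"
    using xy m by (auto simp: ndist_def N(2,7,13))
next
  note N = is_normed_spaceD[OF assms]
  fix x y z assume xyz: "x \<in> points X" "y \<in> points X" "z \<in> points X"
  then have m: "vscale X (-1) y \<in> points X" "vscale X (-1) z \<in> points X"
    by (auto intro: N)
  with xyz have d: "vadd X y (vscale X (-1) z) \<in> points X" "vadd X x (vscale X (-1) y) \<in> points X"
    by (auto intro: N)
  have "vadd X (vscale X (-1) y) y = vzero X"
    using N(5)[OF m(1) xyz(2)] N(7)[OF xyz(2)] by simp
  then have "vadd X (vscale X (-1) y) (vadd X y (vscale X (-1) z)) = vscale X (-1) z"
    using N(4)[OF m(1) xyz(2) m(2)] N(6)[OF m(2)] by simp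
  then have e: "vadd X (vadd X x (vscale X (-1) y)) (vadd X y (vscale X (-1) z)) =
      vadd X x (vscale X (-1) z)"
    using N(4)[OF xyz(1) m(1) d(1)] by simp
  show "ndist X x z \<le> ndist X x y + ndist X y z"
    using N(15)[OF d(2) d(1)] xyz by (simp add: e ndist_def)
qed

lemma is_banach_space_class_structure:
  fixes V :: "'x::real_normed_vector set"
  assumes "subspace V" "complete V"
  shows "is_banach_space (class_structure V)"
proof -
  have N: "is_normed_space (class_structure V)"
    unfolding is_normed_space_def class_structure_def using assms(1)
    by (auto simp: subspace_def algebra_simps norm_triangle_ineq)
  then interpret M: Metric_space V "ndist (class_structure V)"
    using is_normed_space_Metric_space[OF N] by (simp add: class_structure_def)
  have d: "ndist (class_structure V) x y = dist x y" if "x \<in> V" "y \<in> V" for x y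
    using that by (simp add: ndist_def class_structure_def dist_norm)
  have "M.mcomplete"
    unfolding M.mcomplete_def
  proof (intro allI impI)
    fix s assume s: "M.MCauchy s"
    then have sV: "s n \<in> V" for n by (auto simp: M.MCauchy_def)
    have "Cauchy s"
      using s unfolding M.MCauchy_def Cauchy_def by (metis d sV)
    then obtain l where l: "s \<longlonglongrightarrow> l" "l \<in> V"
      using assms(2) sV unfolding complete_def by blast
    then have "limitin M.mtopology s l sequentially"
      using l by (simp add: M.limit_metric_sequentially sV d LIMSEQ_def)
    then show "\<exists>x. limitin M.mtopology s x sequentially" by blast
  qed
  then show ?thesis
    using N by (simp add: is_banach_space_def class_structure_def)
qed

lemma is_banach_space_c0: "is_banach_space c0"
  unfolding c0_def
proof (rule is_banach_space_class_structure)
  let ?V = "{x :: nat \<Rightarrow>\<^sub>C real. apply_bcontfun x \<longlonglongrightarrow> 0}"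
  show "subspace ?V"
    unfolding subspace_def
  proof (intro conjI ballI allI)
    show "0 \<in> ?V" by (simp add: zero_bcontfun.rep_eq)
  next
    fix x y assume "x \<in> ?V" "y \<in> ?V"
    then have "(\<lambda>n. apply_bcontfun x n + apply_bcontfun y n) \<longlonglongrightarrow> 0 + 0"
      by (intro tendsto_add) auto
    then show "x + y \<in> ?V" by (simp add: plus_bcontfun.rep_eq)
  next
    fix c x assume "x \<in> ?V"
    then have "(\<lambda>n. c *\<^sub>R apply_bcontfun x n) \<longlonglongrightarrow> c *\<^sub>R 0"
      by (intro tendsto_intros) auto
    then show "c *\<^sub>R x \<in> ?V" by (simp add: scaleR_bcontfun.rep_eq)
  qed
  show "complete ?V"
    unfolding complete_def
  proof (intro allI impI, elim conjE)
    fix f :: "nat \<Rightarrow> nat \<Rightarrow>\<^sub>C real"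
    assume f: "\<forall>n. f n \<in> ?V" and "Cauchy f"
    then obtain g where "uniform_limit UNIV f g sequentially"
      using uniformly_convergent_eq_cauchy[of "\<lambda>_. True" f]
      unfolding Cauchy_def uniform_limit_sequentially_iff
      by (metis dist_fun_lt_imp_dist_val_lt)
    from uniform_limit_bcontfunE[OF this sequentially_bot]
    obtain l where l: "f \<longlonglongrightarrow> l" by metis
    have "apply_bcontfun l \<longlonglongrightarrow> 0"
    proof (rule LIMSEQ_I)
      fix r :: real assume "r > 0"
      then obtain m where m: "dist (f m) l < r / 2"
        using l unfolding LIMSEQ_def by (metis half_gt_zero order_refl)
      obtain N where N: "\<And>n. n \<ge> N \<Longrightarrow> norm (apply_bcontfun (f m) n - 0) < r / 2"
        using f LIMSEQ_D[of "apply_bcontfun (f m)" 0 "r / 2"] \<open>r > 0\<close> by auto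
      have "norm (apply_bcontfun l n - 0) < r" if "n \<ge> N" for n
        using N[OF that] dist_fun_lt_imp_dist_val_lt[OF m, of n]
        by (simp only: dist_real_def real_norm_def diff_0_right)
      then show "\<exists>N. \<forall>n\<ge>N. norm (apply_bcontfun l n - 0) < r" by blast
    qed
    with l show "\<exists>l\<in>?V. f \<longlonglongrightarrow> l" by blast
  qed
qed

lemma separably_injective_extend:
  fixes X :: "'x normed_structure"
  assumes S: "separably_injective TYPE('s::banach)"
    and X: "is_banach_space X" "separable_space (normed_topology X)"
  shows "operators_extend X TYPE('s)"
proof -
  have NX: "is_normed_space X" and CX: "Metric_space.mcomplete (points X) (ndist X)"
    using X(1) by (auto simp: is_banach_space_def)
  note N = is_normed_spaceD[OF NX]
  interpret M: Metric_space "points X" "ndist X"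
    by (rule is_normed_space_Metric_space[OF NX])
  obtain C where C: "countable C" "C \<subseteq> points X" "M.mtopology closure_of C = points X"
    using X(2) by (auto simp: separable_space_def normed_topology_def)
  have dense: "\<exists>y\<in>C. ndist X x y < r" if "x \<in> points X" "r > 0" for x r
    using C(3) that unfolding M.metric_closure_of by (auto; blast)
  have "C \<noteq> {}" using dense[OF N(1), of 1] by auto
  define h where "h x = (\<lambda>n. ndist X x (from_nat_into C n))" for x
  have inj: "inj_on h (points X)"
  proof (rule inj_onI, rule ccontr)
    fix x y assume xy: "x \<in> points X" "y \<in> points X" "h x = h y" "x \<noteq> y"
    then have "ndist X x y / 2 > 0" by simp
    then obtain z where z: "z \<in> C" "ndist X x z < ndist X x y / 2"
      using dense xy by blast
    then obtain n where "z = from_nat_into C n"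
      using C(1) by (metis from_nat_into_to_nat_on)
    then have "ndist X y z = ndist X x z" using xy(3) unfolding h_def by metis
    then show False
      using z xy M.triangle'[of x z y] C(2) by auto
  qed
  define P where "P = h ` points X"
  define g where "g = inv_into (points X) h"
  have gh [simp]: "g (h x) = x" if "x \<in> points X" for x
    using inj that by (simp add: g_def)
  define X' where "X' = \<lparr>points = P, vadd = (\<lambda>u v. h (vadd X (g u) (g v))), vzero = h (vzero X),
     vscale = (\<lambda>c u. h (vscale X c (g u))), vnorm = (\<lambda>u. vnorm X (g u))\<rparr>"
  have X'_simps [simp]: "points X' = P" "vadd X' u v = h (vadd X (g u) (g v))"
     "vzero X' = h (vzero X)" "vscale X' c u = h (vscale X c (g u))" "vnorm X' u = vnorm X (g u)"
    for u v c by (simp_all add: X'_def)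
  have cl: "vzero X \<in> points X" "\<And>x y. x \<in> points X \<Longrightarrow> y \<in> points X \<Longrightarrow> vadd X x y \<in> points X"
     "\<And>c x. x \<in> points X \<Longrightarrow> vscale X c x \<in> points X"
    by (rule N; assumption)+
  have hP [simp]: "h x \<in> P" if "x \<in> points X" for x using that by (simp add: P_def)
  have gP [simp]: "g u \<in> points X" and hg [simp]: "h (g u) = u" if "u \<in> P" for u
    using that by (auto simp: P_def)
  have h_eq: "h x = h y \<longleftrightarrow> x = y" if "x \<in> points X" "y \<in> points X" for x y
    using inj that by (auto simp: inj_on_def)
  have ball_P: "(\<forall>u\<in>P. Q u) \<longleftrightarrow> (\<forall>x\<in>points X. Q (h x))" for Q
    by (auto simp: P_def)
  have NX': "is_normed_space X'"
    unfolding is_normed_space_def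
    by (simp add: ball_P cl h_eq N(4,6-15)) (blast intro: N(5))
  have d: "ndist X' (h x) (h y) = ndist X x y" if "x \<in> points X" "y \<in> points X" for x y
    using that by (simp add: ndist_def cl)
  interpret M': Metric_space P "ndist X'"
    using is_normed_space_Metric_space[OF NX'] by simp
  have "M'.mcomplete"
    unfolding M'.mcomplete_def
  proof (intro allI impI)
    fix s assume s: "M'.MCauchy s"
    then have sP: "s n \<in> P" for n by (auto simp: M'.MCauchy_def)
    have dg: "ndist X' (s m) (s n) = ndist X (g (s m)) (g (s n))" for m n
      using d[of "g (s m)" "g (s n)"] sP by simp
    have "M.MCauchy (g \<circ> s)"
      using s sP unfolding M.MCauchy_def M'.MCauchy_def by (auto simp: dg)
    then obtain l where l: "limitin M.mtopology (g \<circ> s) l sequentially"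
      using CX unfolding M.mcomplete_def by blast
    then have lX: "l \<in> points X" by (rule M.limitin_mspace)
    have "ndist X' (s n) (h l) = ndist X (g (s n)) l" for n
      using d[of "g (s n)" l] sP lX by simp
    then have "limitin M'.mtopology s (h l) sequentially"
      using l lX by (simp add: M.limit_metric_sequentially M'.limit_metric_sequentially sP)
    then show "\<exists>x. limitin M'.mtopology s x sequentially" by blast
  qed
  then have BX': "is_banach_space X'"
    using NX' by (simp add: is_banach_space_def)
  have "M'.mtopology closure_of (h ` C) = P"
  proof -
    have "\<exists>v\<in>h ` C. v \<in> M'.mball u r" if u: "u \<in> P" and r: "r > 0" for u r
    proof -
      obtain y where y: "y \<in> C" "ndist X (g u) y < r"
        using dense[of "g u" r] u r by auto
      then have "y \<in> points X" using C(2) by blast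
      then have "h y \<in> M'.mball u r"
        using d[of "g u" y] y u by simp
      with y(1) show ?thesis by blast
    qed
    then show ?thesis
      unfolding M'.metric_closure_of by blast
  qed
  moreover have "countable (h ` C)" "h ` C \<subseteq> P"
    using C by (auto simp: P_def)
  ultimately have "separable_space (normed_topology X')"
    unfolding separable_space_def normed_topology_def by auto
  with BX' S have E: "operators_extend X' TYPE('s)"
    by (simp add: separably_injective_def)
  show ?thesis
    unfolding operators_extend_def
  proof (intro allI impI, elim conjE)
    fix Y and T :: "'x \<Rightarrow> 's"
    assume Y: "closed_subspace X Y" and T: "bounded_operator_on X Y T"
    have cY: "closedin M.mtopology Y"
      using Y by (simp add: closed_subspace_def normed_topology_def)
    then have YX: "Y \<subseteq> points X" using M.closedin_metric by blast
    have "closedin M'.mtopology (h ` Y)"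
      unfolding M'.closedin_metric
    proof (intro conjI allI impI)
      show "h ` Y \<subseteq> P" using YX by auto
      fix u assume u: "u \<in> P - h ` Y"
      then have "g u \<in> points X - Y" by (metis Diff_iff gP hg imageI)
      then obtain r where r: "r > 0" "disjnt Y (M.mball (g u) r)"
        using cY unfolding M.closedin_metric by blast
      have "ndist X' u (h y) = ndist X (g u) y" if "y \<in> Y" for y
        using d[of "g u" y] u that YX by auto
      then have "disjnt (h ` Y) (M'.mball u r)"
        using r u YX unfolding disjnt_iff by (metis DiffD1 M'.in_mball M.in_mball gP imageE subsetD)
      with r show "\<exists>r>0. disjnt (h ` Y) (M'.mball u r)" by blast
    qed
    then have "closed_subspace X' (h ` Y)"
      using Y YX by (auto simp: closed_subspace_def normed_topology_def subset_iff)
    moreover have "bounded_operator_on X' (h ` Y) (T \<circ> g)"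
      using T YX by (auto simp: bounded_operator_on_def subset_iff cl)
    ultimately obtain T' :: "(nat \<Rightarrow> real) \<Rightarrow> 's"
      where T': "bounded_operator_on X' P T'" "\<forall>u\<in>h ` Y. T' u = (T \<circ> g) u"
      using E unfolding operators_extend_def by (metis X'_simps(1))
    have "bounded_operator_on X (points X) (T' \<circ> h)"
      using T'(1) by (simp add: bounded_operator_on_def ball_P cl)
    moreover have "\<forall>y\<in>Y. (T' \<circ> h) y = T y"
      using T'(2) YX by auto
    ultimately show "\<exists>T'. bounded_operator_on X (points X) T' \<and> (\<forall>y\<in>Y. T' y = T y)"
      by blast
  qed
qed

end

theory Submission
  imports Defs
begin

text \<open>
  Let \<open>T : Y \<rightarrow> Q\<close> be an operator on a closed subspace \<open>Y\<close> of \<open>c\<^sub>0\<close>.  The point is that \<open>T\<close>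
  lifts through \<open>q\<close>: there is an operator \<open>\<tau> : Y \<rightarrow> E\<close> with \<open>q \<circ> \<tau> = T\<close>
  (\<open>lift_operator_from_separable_subspace\<close>).  Since \<open>E\<close> is an LP space, \<open>\<tau>\<close> extends to
  \<open>\<tau>' : c\<^sub>0 \<rightarrow> E\<close>, and \<open>q \<circ> \<tau>'\<close> extends \<open>T\<close>.

  The lift exists because the pull-back extension \<open>0 \<rightarrow> S \<rightarrow> P \<rightarrow> Y \<rightarrow> 0\<close>, where \<open>P\<close> consists of the
  pairs \<open>(e, h)\<close> with \<open>q e = T h\<close>, splits.  Splitting it amounts to extending an operator into
  \<open>S\<close>, but \<open>P\<close> need not be separable, so separable injectivity does not apply to it directly.
  As \<open>Y\<close> is separable, however, there is a closed separable subspace \<open>Z\<close> of \<open>P\<close> that still maps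
  onto \<open>Y\<close>: the closed span of bounded lifts of a countable dense subset of \<open>Y\<close>.  The kernel
  \<open>N\<close> of \<open>Z \<rightarrow> Y\<close> lies in the copy of \<open>S\<close>, and the inclusion \<open>N \<rightarrow> S\<close> extends to an operator
  \<open>M : Z \<rightarrow> S\<close>.  The operator \<open>(e, h) \<mapsto> e - i (M (e, h))\<close> on \<open>Z\<close> vanishes on \<open>N\<close>, hence depends on
  \<open>h\<close> only, and defines \<open>\<tau>\<close>.

  Boundedness at each stage rests on the open mapping theorem
  (\<open>bounded_preimages_of_closed_range\<close>), applied to \<open>i\<close> and to \<open>q\<close>, and on the successive
  approximation behind it (\<open>exact_lift_from_approximate_lift\<close>), which also gives bounded
  preimages under \<open>Z \<rightarrow> Y\<close>.
\<close>

section \<open>Bounded preimages\<close>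

text \<open>
  Successive approximation: correct the remaining error by an approximate preimage of it, halving
  the error at each step.  The corrections then add up to a geometric series, whence the factor 2.
\<close>

lemma exact_lift_from_approximate_lift:
  fixes f :: "'a::real_normed_vector \<Rightarrow> 'b::real_normed_vector"
  assumes f: "bounded_linear f"
    and U: "subspace U" "complete U"
    and V: "subspace V" "f ` U \<subseteq> V"
    and approx: "\<And>y \<epsilon>. y \<in> V \<Longrightarrow> \<epsilon> > 0 \<Longrightarrow> \<exists>x\<in>U. norm x \<le> C * norm y \<and> norm (y - f x) < \<epsilon>"
    and y: "y \<in> V"
  shows "\<exists>x\<in>U. f x = y \<and> norm x \<le> 2 * C * norm y"
proof (cases "y = 0")
  case True
  then show ?thesis
    using subspace_0[OF U(1)] linear_0[OF bounded_linear.linear[OF f]] by auto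
next
  case False
  define e where "e n = norm y * (1/2) ^ n" for n
  have e: "e n > 0" for n using False by (simp add: e_def)
  define pick where
    "pick n r = (SOME x. x \<in> U \<and> norm x \<le> C * norm r \<and> norm (r - f x) < e (Suc n))" for n r
  have pick: "pick n r \<in> U" "norm (pick n r) \<le> C * norm r" "norm (r - f (pick n r)) < e (Suc n)"
    if "r \<in> V" for n r
  proof -
    have "\<exists>x. x \<in> U \<and> norm x \<le> C * norm r \<and> norm (r - f x) < e (Suc n)"
      using approx[OF that e] by blast
    from someI_ex[OF this] show "pick n r \<in> U" "norm (pick n r) \<le> C * norm r"
      "norm (r - f (pick n r)) < e (Suc n)" by (auto simp: pick_def)
  qed
  define r where "r = rec_nat y (\<lambda>n r. r - f (pick n r))"
  have r_0: "r 0 = y" and r_Suc: "r (Suc n) = r n - f (pick n (r n))" for n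
    by (simp_all add: r_def)
  have rV: "r n \<in> V" for n
    using V pick(1) y by (induction n) (auto simp: r_0 r_Suc intro!: subspace_diff)
  have r_le: "norm (r n) \<le> e n" for n
    by (cases n) (use pick(3)[OF rV] in \<open>auto simp: r_0 r_Suc e_def less_imp_le\<close>)
  have "0 \<le> C * norm y" using approx[OF y zero_less_one] norm_ge_zero order_trans by blast
  then have C: "C \<ge> 0" using False by (simp add: zero_le_mult_iff)
  define x where "x n = pick n (r n)" for n
  have x_le: "norm (x n) \<le> C * e n" for n
    using pick(2)[OF rV[of n], of n] mult_left_mono[OF r_le[of n] C] by (simp add: x_def)
  define S where "S n = (\<Sum>k<n. x k)" for n
  have S_U: "S n \<in> U" for n
    unfolding S_def x_def by (intro subspace_sum[OF U(1)] pick rV)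
  \<comment> \<open>The bound telescopes, because \<open>e k = 2 * (e k - e (Suc k))\<close>.\<close>
  have tail: "norm (S (n + k) - S n) \<le> 2 * C * (e n - e (n + k))" for n k
  proof (induction k)
    case (Suc k)
    have "S (n + Suc k) - S n = (S (n + k) - S n) + x (n + k)" by (simp add: S_def)
    also have "norm \<dots> \<le> 2 * C * (e n - e (n + k)) + C * e (n + k)"
      by (intro norm_triangle_le add_mono Suc x_le)
    also have "\<dots> = 2 * C * (e n - e (n + Suc k))" by (simp add: e_def algebra_simps)
    finally show ?case .
  qed simp
  have e_lim: "e \<longlonglongrightarrow> 0"
    unfolding e_def by (intro tendsto_mult_right_zero LIMSEQ_power_zero) simp
  have "Cauchy S"
  proof (rule CauchyI')
    fix \<epsilon> :: real assume "\<epsilon> > 0"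
    moreover have "(\<lambda>n. 2 * C * e n) \<longlonglongrightarrow> 0" using e_lim by (rule tendsto_mult_right_zero)
    ultimately obtain N where N: "\<And>n. n \<ge> N \<Longrightarrow> norm (2 * C * e n - 0) < \<epsilon>"
      using LIMSEQ_D by blast
    have "dist (S m) (S n) < \<epsilon>" if "m \<ge> N" "n > m" for m n
    proof -
      have "dist (S m) (S n) \<le> 2 * C * (e m - e n)"
        using tail[of m "n - m"] \<open>n > m\<close> by (simp add: dist_norm norm_minus_commute)
      also have "\<dots> \<le> 2 * C * e m" using C e[of n] by (intro mult_left_mono) auto
      also have "\<dots> < \<epsilon>" using N[OF \<open>m \<ge> N\<close>] by simp
      finally show ?thesis .
    qed
    then show "\<exists>N. \<forall>m\<ge>N. \<forall>n>m. dist (S m) (S n) < \<epsilon>" by blast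
  qed
  then obtain l where l: "l \<in> U" "S \<longlonglongrightarrow> l"
    using U(2) S_U unfolding complete_def by blast
  have f_partial: "f (S n) = y - r n" for n
    by (induction n)
      (auto simp: S_def r_0 r_Suc x_def linear_0 linear_add bounded_linear.linear[OF f])
  have "r \<longlonglongrightarrow> 0"
    using e_lim by (rule Lim_null_comparison[rotated]) (simp add: r_le)
  then have "(\<lambda>n. f (S n)) \<longlonglongrightarrow> y - 0"
    unfolding f_partial by (intro tendsto_intros)
  moreover have "(\<lambda>n. f (S n)) \<longlonglongrightarrow> f l"
    by (intro bounded_linear.tendsto[OF f] l)
  ultimately have "f l = y" using LIMSEQ_unique by fastforce
  moreover have "norm l \<le> 2 * C * norm y"
  proof (rule LIMSEQ_le_const2[OF tendsto_norm[OF l(2)]])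
    have "norm (S n) \<le> 2 * C * norm y" for n
    proof -
      have "norm (S n) \<le> 2 * C * (e 0 - e n)" using tail[of 0 n] by (simp add: S_def)
      also have "\<dots> \<le> 2 * C * e 0" using C e[of n] by (intro mult_left_mono) auto
      finally show ?thesis by (simp add: e_def)
    qed
    then show "\<exists>N. \<forall>n\<ge>N. norm (S n) \<le> 2 * C * norm y" by blast
  qed
  ultimately show ?thesis using l(1) by blast
qed

text \<open>
  The open mapping theorem onto the range.  By Baire's theorem the closure of the image of some
  ball contains a relatively open piece of the range around a point \<open>v\<close>; differences of two points of this
  piece give approximate preimages with a uniform bound, which can be made exact.
\<close>

lemma bounded_preimages_of_closed_range:
  fixes f :: "'a::banach \<Rightarrow> 'b::banach"
  assumes f: "bounded_linear f" and cl: "closed (range f)"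
  obtains C where "C > 0" "\<And>y. y \<in> range f \<Longrightarrow> \<exists>x. f x = y \<and> norm x \<le> C * norm y"
proof -
  interpret f: bounded_linear f by fact
  define W where "W n = closure (f ` cball 0 (real n))" for n
  have sub: "subspace (range f)"
    using f.linear_axioms linear_subspace_image subspace_UNIV by blast
  have W: "W n \<subseteq> range f" "closedin (top_of_set (range f)) (W n)" for n
  proof -
    show "W n \<subseteq> range f"
      unfolding W_def by (rule closure_minimal) (auto simp: cl)
    then show "closedin (top_of_set (range f)) (W n)"
      by (simp add: closed_subset W_def)
  qed
  have "\<Union>(range W) = range f"
  proof
    have "f x \<in> W (nat \<lceil>norm x\<rceil>)" for x
      unfolding W_def by (rule subsetD[OF closure_subset]) (auto intro: real_nat_ceiling_ge)
    then show "range f \<subseteq> \<Union>(range W)" by blast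
  qed (use W in blast)
  then have "top_of_set (range f) interior_of \<Union>(range W) \<noteq> {}"
    by (metis interior_of_topspace range_eqI empty_iff topspace_euclidean_subtopology)
  moreover have "completely_metrizable_space (top_of_set (range f))"
    using cl by (simp add: completely_metrizable_space_closedin completely_metrizable_space_euclidean)
  ultimately obtain n where "top_of_set (range f) interior_of (W n) \<noteq> {}"
    using Baire_category_alt[of "top_of_set (range f)" "range W"] W(2) by auto
  then obtain G v where G: "openin (top_of_set (range f)) G" "v \<in> G" "G \<subseteq> W n"
    unfolding interior_of_def by auto
  then obtain r where r: "r > 0" "\<And>y. y \<in> range f \<Longrightarrow> dist y v < r \<Longrightarrow> y \<in> W n" and v: "v \<in> range f"
    unfolding openin_euclidean_subtopology_iff by blast
  have approx: "\<exists>x\<in>UNIV. norm x \<le> (4 * real n / r) * norm y \<and> norm (y - f x) < \<epsilon>"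
    if y: "y \<in> range f" and \<epsilon>: "\<epsilon> > 0" for y \<epsilon>
  proof (cases "y = 0")
    case True
    then show ?thesis using \<epsilon> by (intro bexI[of _ 0]) (auto simp: f.zero)
  next
    case False
    \<comment> \<open>Rescale \<open>y\<close> to norm \<open>r / 2\<close>, so that it is a difference of two points near \<open>v\<close>.\<close>
    define t where "t = r / (2 * norm y)"
    have t: "t > 0" using False r by (simp add: t_def)
    have "norm (t *\<^sub>R y) < r" using False r by (simp add: t_def)
    then have "v + t *\<^sub>R y \<in> W n" "v \<in> W n"
      using r v y sub by (auto intro!: r(2) subspace_add subspace_scale simp: dist_norm)
    then obtain a b where ab: "norm a \<le> n" "norm b \<le> n"
      "dist (f a) (v + t *\<^sub>R y) < t * \<epsilon> / 2" "dist (f b) v < t * \<epsilon> / 2"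
      unfolding W_def closure_approachable using t \<epsilon> by (force dest!: spec[of _ "t * \<epsilon> / 2"])
    define x where "x = (a - b) /\<^sub>R t"
    have "norm (t *\<^sub>R y - f (a - b)) < t * \<epsilon>"
    proof -
      have "t *\<^sub>R y - f (a - b) = (f b - v) - (f a - (v + t *\<^sub>R y))" by (simp add: f.diff)
      then have "norm (t *\<^sub>R y - f (a - b)) \<le> dist (f b) v + dist (f a) (v + t *\<^sub>R y)"
        unfolding dist_norm by (metis norm_triangle_ineq4)
      then show ?thesis using ab(3,4) by linarith
    qed
    moreover have "t *\<^sub>R y - f (a - b) = t *\<^sub>R (y - f x)"
      using t by (simp add: x_def f.scaleR algebra_simps f.diff)
    ultimately have "norm (y - f x) < \<epsilon>" using t by simp
    moreover have "norm x \<le> (4 * real n / r) * norm y"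
    proof -
      have "norm x = norm (a - b) / t" using t by (simp add: x_def divide_inverse mult.commute)
      also have "\<dots> \<le> (2 * real n) / t"
        using norm_triangle_ineq4[of a b] ab(1,2) t by (intro divide_right_mono) auto
      also have "\<dots> = (4 * real n / r) * norm y" using r False by (simp add: t_def field_simps)
      finally show ?thesis .
    qed
    ultimately show ?thesis by blast
  qed
  have lift: "\<exists>x. f x = y \<and> norm x \<le> 2 * (4 * real n / r) * norm y" if "y \<in> range f" for y
    using exact_lift_from_approximate_lift[OF f subspace_UNIV complete_UNIV sub _ approx that] by auto
  show thesis
  proof (rule that[of "2 * (4 * real n / r) + 1"])
    show "2 * (4 * real n / r) + 1 > 0" using r by (simp add: add_nonneg_pos)
    show "\<exists>x. f x = y \<and> norm x \<le> (2 * (4 * real n / r) + 1) * norm y" if y: "y \<in> range f" for y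
    proof -
      obtain x where "f x = y" "norm x \<le> 2 * (4 * real n / r) * norm y" using lift[OF y] by blast
      then show ?thesis by (intro exI[of _ x]) (simp add: distrib_right add_increasing2)
    qed
  qed
qed

section \<open>Separability\<close>

text \<open>
  The rational linear combinations of \<open>B\<close> form a countable set, and since the rationals are dense
  in the reals its closure is closed under all real multiples.
\<close>

lemma countable_dense_subset_of_span:
  fixes B :: "'a::real_normed_vector set"
  assumes "countable B"
  obtains D where "countable D" "B \<subseteq> D" "D \<subseteq> span B" "subspace (closure D)"
proof -
  define L where "L = lists (\<rat> \<times> B :: (real \<times> 'a) set)"
  define lc where "lc xs = (\<Sum>(c, b)\<leftarrow>xs. c *\<^sub>R b)" for xs :: "(real \<times> 'a) list"
  define D where "D = lc ` L"
  have "countable D"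
    unfolding D_def L_def
    by (intro countable_image countable_lists countable_SIGMA countable_rat assms)
  moreover have "B \<subseteq> D"
  proof
    fix b assume "b \<in> B"
    then have "[(1, b)] \<in> L" "lc [(1, b)] = b" by (auto simp: L_def lc_def)
    then show "b \<in> D" unfolding D_def by (metis imageI)
  qed
  moreover have "D \<subseteq> span B"
  proof -
    have "lc xs \<in> span B" if "xs \<in> L" for xs
      using that unfolding L_def lc_def
      by (induction xs) (auto intro!: span_add span_scale intro: span_base simp: span_zero)
    then show ?thesis by (auto simp: D_def)
  qed
  moreover have "subspace (closure D)"
  proof -
    have add: "x + y \<in> D" if xy: "x \<in> D" "y \<in> D" for x y
    proof -
      obtain xs ys where "x = lc xs" "xs \<in> L" "y = lc ys" "ys \<in> L"
        using xy unfolding D_def by blast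
      then have "x + y = lc (xs @ ys)" "xs @ ys \<in> L" by (auto simp: lc_def L_def)
      then show ?thesis by (auto simp: D_def)
    qed
    have scale: "c *\<^sub>R x \<in> D" if x: "x \<in> D" and c: "c \<in> \<rat>" for x c
    proof -
      obtain xs where xs: "x = lc xs" "xs \<in> L" using x by (auto simp: D_def)
      have "c *\<^sub>R lc xs = lc (map (\<lambda>(d, b). (c * d, b)) xs)"
        by (induction xs) (auto simp: lc_def scaleR_add_right)
      moreover have "map (\<lambda>(d, b). (c * d, b)) xs \<in> L"
        using xs(2) c by (auto simp: L_def lists_eq_set)
      ultimately show ?thesis using xs(1) by (auto simp: D_def)
    qed
    have "0 \<in> D" unfolding D_def by (rule image_eqI[of _ _ "[]"]) (auto simp: lc_def L_def)
    show ?thesis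
      unfolding subspace_def
    proof (intro conjI ballI allI)
      show "0 \<in> closure D" using \<open>0 \<in> D\<close> closure_subset by blast
    next
      fix x y assume "x \<in> closure D" "y \<in> closure D"
      then obtain s t where "\<And>n. s n \<in> D" "s \<longlonglongrightarrow> x" "\<And>n. t n \<in> D" "t \<longlonglongrightarrow> y"
        unfolding closure_sequential by blast
      then show "x + y \<in> closure D"
        unfolding closure_sequential
        by (intro exI[of _ "\<lambda>n. s n + t n"] conjI allI add tendsto_add)
    next
      fix c :: real and x assume "x \<in> closure D"
      then obtain s where s: "\<And>n. s n \<in> D" "s \<longlonglongrightarrow> x" unfolding closure_sequential by blast
      have "c \<in> closure \<rat>"
        unfolding closure_approachable
      proof (intro allI impI)
        fix \<epsilon> :: real assume "\<epsilon> > 0"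
        then obtain d where "d \<in> \<rat>" "c < d" "d < c + \<epsilon>"
          using Rats_dense_in_real[of c "c + \<epsilon>"] by auto
        then show "\<exists>d\<in>\<rat>. dist d c < \<epsilon>" by (intro bexI[of _ d]) (auto simp: dist_real_def)
      qed
      then obtain d where d: "\<And>n. d n \<in> \<rat>" "d \<longlonglongrightarrow> c" unfolding closure_sequential by blast
      have "(\<lambda>n. d n *\<^sub>R s n) \<longlonglongrightarrow> c *\<^sub>R x" by (intro tendsto_scaleR s d)
      then show "c *\<^sub>R x \<in> closure D"
        unfolding closure_sequential
        by (intro exI[of _ "\<lambda>n. d n *\<^sub>R s n"] conjI allI scale s d)
    qed
  qed
  ultimately show thesis by (rule that)
qed

text \<open>
  Subsets inherit separability, although \<open>D\<close> itself may miss \<open>H\<close>: for each point of \<open>D\<close> and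
  each \<open>n\<close>, choose a point of \<open>H\<close> within \<open>1 / (n + 1)\<close> of it, if there is one.
\<close>

lemma countable_dense_subset_of_subset:
  fixes H :: "'a::metric_space set"
  assumes D: "countable D" and H: "H \<subseteq> closure D"
  obtains B where "countable B" "B \<subseteq> H" "H \<subseteq> closure B"
proof -
  define I where "I = {(d, n). d \<in> D \<and> (\<exists>h\<in>H. dist d h < 1 / real (Suc n))}"
  define p where "p = (\<lambda>(d, n). SOME h. h \<in> H \<and> dist d h < 1 / real (Suc n))"
  have p: "p (d, n) \<in> H" "dist d (p (d, n)) < 1 / real (Suc n)" if "(d, n) \<in> I" for d n
  proof -
    have "\<exists>h. h \<in> H \<and> dist d h < 1 / real (Suc n)" using that by (auto simp: I_def)
    from someI_ex[OF this] show "p (d, n) \<in> H" "dist d (p (d, n)) < 1 / real (Suc n)"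
      by (auto simp: p_def)
  qed
  show thesis
  proof (rule that[of "p ` I"])
    have "countable (D \<times> (UNIV :: nat set))" using D by simp
    then have "countable I" by (rule countable_subset[rotated]) (auto simp: I_def)
    then show "countable (p ` I)" by simp
    show "p ` I \<subseteq> H" using p(1) by auto
    show "H \<subseteq> closure (p ` I)"
      unfolding closure_approachable
    proof (intro subsetI, unfold closure_approachable, intro allI impI)
      fix h \<epsilon> :: real and x assume x: "x \<in> H" and "\<epsilon> > 0"
      then obtain n where n: "1 / real (Suc n) < \<epsilon> / 2"
        using nat_approx_posE[of "\<epsilon> / 2"] by (metis half_gt_zero)
      obtain d where d: "d \<in> D" "dist d x < 1 / real (Suc n)"
        using H x unfolding closure_approachable
        by (metis closure_approachable of_nat_0_less_iff subsetD zero_less_Suc zero_less_divide_1_iff)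
      then have I: "(d, n) \<in> I" using x by (auto simp: I_def)
      have "dist (p (d, n)) x < \<epsilon>"
        using dist_triangle[of "p (d, n)" x d] p(2)[OF I] d(2) n by (simp add: dist_commute)
      then show "\<exists>y\<in>p ` I. dist y x < \<epsilon>" using I by blast
    qed
  qed
qed

lemma points_c0: "points c0 = {x. apply_bcontfun x \<longlonglongrightarrow> 0}"
  by (simp add: c0_def class_structure_def)

text \<open>
  The truncations of a null sequence converge to it uniformly, so the unit sequences \<open>\<delta> k\<close> span a
  dense subspace.
\<close>

lemma c0_separable:
  obtains D :: "(nat \<Rightarrow>\<^sub>C real) set" where "countable D" "points c0 \<subseteq> closure D"
proof -
  define \<delta> :: "nat \<Rightarrow> (nat \<Rightarrow>\<^sub>C real)" where "\<delta> k = Bcontfun (\<lambda>n. if n = k then 1 else 0)" for k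
  have \<delta>: "apply_bcontfun (\<delta> k) n = (if n = k then 1 else 0)" for k n
  proof -
    have "(\<lambda>n. if n = k then 1 else 0 :: real) \<in> bcontfun"
      by (rule bcontfun_normI[where b = 1]) auto
    then show ?thesis by (simp add: \<delta>_def Bcontfun_inverse)
  qed
  obtain D where D: "countable D" "range \<delta> \<subseteq> D" "subspace (closure D)"
    by (rule countable_dense_subset_of_span[of "range \<delta>"]) simp_all
  have "x \<in> closure D" if x: "x \<in> points c0" for x
  proof -
    have lim: "apply_bcontfun x \<longlonglongrightarrow> 0" using x by (simp add: points_c0)
    define s where "s N = (\<Sum>k<N. apply_bcontfun x k *\<^sub>R \<delta> k)" for N
    have s: "apply_bcontfun (s N) n = (if n < N then apply_bcontfun x n else 0)" for N n
      by (induction N) (auto simp: s_def \<delta> less_Suc_eq)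
    have "s N \<in> closure D" for N
      unfolding s_def using D closure_subset
      by (intro subspace_sum[OF D(3)] subspace_scale[OF D(3)]) blast
    moreover have "\<exists>N. dist (s N) x \<le> \<epsilon>" if \<epsilon>: "\<epsilon> > 0" for \<epsilon>
    proof -
      obtain N where N: "\<And>n. n \<ge> N \<Longrightarrow> norm (apply_bcontfun x n - 0) < \<epsilon>"
        using LIMSEQ_D[OF lim \<epsilon>] by blast
      have "dist (s N) x \<le> \<epsilon>"
      proof (rule dist_bound)
        fix n show "dist (apply_bcontfun (s N) n) (apply_bcontfun x n) \<le> \<epsilon>"
          using N[of n] \<epsilon> by (auto simp: s dist_real_def)
      qed
      then show ?thesis ..
    qed
    ultimately have "x \<in> closure (closure D)"
      by (subst closure_approachable_le) metis
    then show ?thesis by simp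
  qed
  with D(1) show thesis by (intro that[of D]) auto
qed

section \<open>Subspaces of normed spaces as structures\<close>

lemma normed_topology_class_structure:
  assumes "subspace V"
  shows "normed_topology (class_structure V) = top_of_set V"
proof -
  have N: "is_normed_space (class_structure V)"
    unfolding is_normed_space_def class_structure_def using assms
    by (auto simp: subspace_def algebra_simps norm_triangle_ineq)
  interpret M: Metric_space V "ndist (class_structure V)"
    using is_normed_space_Metric_space[OF N] by (simp add: class_structure_def)
  have d: "ndist (class_structure V) x y = dist x y" if "x \<in> V" "y \<in> V" for x y
    using that by (simp add: ndist_def class_structure_def dist_norm)
  have ball: "M.mball x r = {y \<in> V. dist y x < r}" if "x \<in> V" for x r
    using that d by (auto simp: M.mball_def dist_commute)
  have "openin M.mtopology U \<longleftrightarrow> openin (top_of_set V) U" for U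
    unfolding M.openin_mtopology openin_euclidean_subtopology_iff
  proof (rule conj_cong[OF refl])
    assume "U \<subseteq> V"
    then have "M.mball x r \<subseteq> U \<longleftrightarrow> (\<forall>y\<in>V. dist y x < r \<longrightarrow> y \<in> U)" if "x \<in> U" for x r
      using that by (auto simp: ball subset_iff)
    then show "(\<forall>x. x \<in> U \<longrightarrow> (\<exists>r>0. M.mball x r \<subseteq> U)) \<longleftrightarrow>
        (\<forall>x\<in>U. \<exists>e>0. \<forall>y\<in>V. dist y x < e \<longrightarrow> y \<in> U)"
      by auto
  qed
  then show ?thesis
    by (simp add: normed_topology_def class_structure_def topology_eq)
qed

lemma is_banach_space_class_structureD:
  fixes V :: "'x::real_normed_vector set"
  assumes "is_banach_space (class_structure V)"
  shows "subspace V" "complete V"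
proof -
  have N: "is_normed_space (class_structure V)"
    and C: "Metric_space.mcomplete V (ndist (class_structure V))"
    using assms by (auto simp: is_banach_space_def class_structure_def)
  interpret M: Metric_space V "ndist (class_structure V)"
    using is_normed_space_Metric_space[OF N] by (simp add: class_structure_def)
  have d: "ndist (class_structure V) x y = dist x y" if "x \<in> V" "y \<in> V" for x y
    using that by (simp add: ndist_def class_structure_def dist_norm)
  show "subspace V"
    using is_normed_spaceD(1-3)[OF N] by (auto simp: subspace_def class_structure_def)
  show "complete V"
    unfolding complete_def
  proof (intro allI impI, elim conjE)
    fix s assume s: "\<forall>n. s n \<in> V" "Cauchy s"
    then have "M.MCauchy s" by (auto simp: M.MCauchy_def Cauchy_def d)
    then obtain l where l: "limitin M.mtopology s l sequentially"
      using C by (auto simp: M.mcomplete_def)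
    then have "l \<in> V" by (rule M.limitin_mspace)
    moreover have "s \<longlonglongrightarrow> l"
      using l s(1) \<open>l \<in> V\<close> by (simp add: M.limit_metric_sequentially LIMSEQ_def d)
    ultimately show "\<exists>l\<in>V. s \<longlonglongrightarrow> l" by blast
  qed
qed

lemma points_class_structure: "points (class_structure V) = V"
  by (simp add: class_structure_def)

lemma closed_subspace_class_structure:
  assumes "subspace V" "closed V"
  shows "closed_subspace (class_structure V) Y \<longleftrightarrow> Y \<subseteq> V \<and> subspace Y \<and> closed Y"
  unfolding closed_subspace_def normed_topology_class_structure[OF assms(1)]
  using assms(2) closedin_closed_trans[of V Y] closedin_imp_subset[of euclidean V Y] closed_subset[of Y V]
  by (auto simp: class_structure_def subspace_def)

lemma bounded_operator_on_class_structure: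
  "bounded_operator_on (class_structure V) Y T \<longleftrightarrow>
     (\<forall>x\<in>Y. \<forall>y\<in>Y. T (x + y) = T x + T y) \<and> (\<forall>c. \<forall>x\<in>Y. T (c *\<^sub>R x) = c *\<^sub>R T x) \<and>
     (\<exists>K. \<forall>x\<in>Y. norm (T x) \<le> K * norm x)"
  by (simp add: bounded_operator_on_def class_structure_def)


section \<open>Lifting operators from separable spaces\<close>

lemma complete_UNIV_Times:
  fixes H :: "'b::metric_space set"
  assumes "complete H"
  shows "complete ((UNIV :: 'a::complete_space set) \<times> H)"
  unfolding complete_def
proof (intro allI impI, elim conjE)
  fix z :: "nat \<Rightarrow> 'a \<times> _" assume z: "\<forall>n. z n \<in> UNIV \<times> H" "Cauchy z"
  have "convergent (\<lambda>n. fst (z n))"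
    using Cauchy_convergent[OF Cauchy_fst[OF z(2)]] .
  then obtain a where a: "(\<lambda>n. fst (z n)) \<longlonglongrightarrow> a" by (auto simp: convergent_def)
  have "snd (z n) \<in> H" for n using z(1) by (simp add: mem_Times_iff)
  then obtain h where h: "h \<in> H" "(\<lambda>n. snd (z n)) \<longlonglongrightarrow> h"
    by (metis completeE[OF assms _ Cauchy_snd[OF z(2)]])
  have "z \<longlonglongrightarrow> (a, h)" using tendsto_Pair[OF a h(2)] by simp
  then show "\<exists>l\<in>UNIV \<times> H. z \<longlonglongrightarrow> l" using h(1) by blast
qed

text \<open>
  Every extension of a separable Banach space \<open>H\<close> by \<open>S\<close> splits; for the pull-back of the given
  sequence along \<open>T\<close>, a splitting is the same as a lift of \<open>T\<close>.
\<close>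

lemma lift_operator_from_separable_subspace:
  fixes i :: "'s::banach \<Rightarrow> 'e::banach" and q :: "'e \<Rightarrow> 'q::banach" and T :: "'x::real_normed_vector \<Rightarrow> 'q"
  assumes exact: "short_exact_sequence i q"
    and S: "separably_injective TYPE('s)"
    and H: "subspace H" "complete H"
    and D: "countable D" "H \<subseteq> closure D"
    and T: "bounded_operator_on (class_structure V) H T"
  obtains \<tau> where "bounded_operator_on (class_structure V) H \<tau>" "\<And>h. h \<in> H \<Longrightarrow> q (\<tau> h) = T h"
proof -
  interpret i: bounded_linear i using exact by (simp add: short_exact_sequence_def)
  interpret q: bounded_linear q using exact by (simp add: short_exact_sequence_def)
  have i_inj: "i s = 0 \<longleftrightarrow> s = 0" for s
    using exact by (auto simp: short_exact_sequence_def)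
  have ker_q: "q e = 0 \<longleftrightarrow> e \<in> range i" for e
    using exact by (auto simp: short_exact_sequence_def)
  have qi: "q (i s) = 0" for s by (simp add: ker_q)
  have q_surj: "range q = UNIV" using exact by (simp add: short_exact_sequence_def)
  have "range i = q -` {0}" using ker_q by auto
  then have "closed (range i)"
    using closed_vimage[OF closed_singleton, of q 0] q.continuous_on[OF continuous_on_id] by simp
  from bounded_preimages_of_closed_range[OF i.bounded_linear this]
  obtain Ci where Ci: "Ci > 0" "\<And>y. y \<in> range i \<Longrightarrow> \<exists>x. i x = y \<and> norm x \<le> Ci * norm y" by blast
  from bounded_preimages_of_closed_range[OF q.bounded_linear]
  obtain Cq where Cq: "Cq > 0" "\<And>y. \<exists>x. q x = y \<and> norm x \<le> Cq * norm y"
    unfolding q_surj by auto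
  obtain K where T_add: "\<And>x y. x \<in> H \<Longrightarrow> y \<in> H \<Longrightarrow> T (x + y) = T x + T y"
    and T_scale: "\<And>c x. x \<in> H \<Longrightarrow> T (c *\<^sub>R x) = c *\<^sub>R T x"
    and K: "\<And>x. x \<in> H \<Longrightarrow> norm (T x) \<le> K * norm x"
    using T unfolding bounded_operator_on_class_structure by blast
  have T_0: "T 0 = 0" using T_scale[of 0 0] subspace_0[OF H(1)] by simp

  \<comment> \<open>The pull-back of \<open>q\<close> along \<open>T\<close>.\<close>
  define P where "P = {(e, h). h \<in> H \<and> q e = T h}"
  have P: "subspace P"
    unfolding subspace_def P_def
    using H(1) by (auto simp: zero_prod_def q.zero T_0 q.add T_add q.scaleR T_scale subspace_def)
  have "closed P"
    unfolding closed_sequential_limits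
  proof (intro allI impI, elim conjE)
    fix z l assume z: "\<forall>n. z n \<in> P" and "z \<longlonglongrightarrow> l"
    then have lim: "(\<lambda>n. fst (z n)) \<longlonglongrightarrow> fst l" "(\<lambda>n. snd (z n)) \<longlonglongrightarrow> snd l"
      by (auto intro: tendsto_fst tendsto_snd)
    have zH: "snd (z n) \<in> H" and qz: "q (fst (z n)) = T (snd (z n))" for n
      using z by (auto simp: P_def split_beta)
    have lH: "snd l \<in> H" using closed_sequentially[OF complete_imp_closed[OF H(2)] _ lim(2)] zH by blast
    have "T (snd (z n)) - T (snd l) = T (snd (z n) - snd l)" for n
      using T_add[of "snd (z n) - snd l" "snd l"] subspace_diff[OF H(1) zH lH] lH by simp
    then have le: "norm (T (snd (z n)) - T (snd l)) \<le> K * norm (snd (z n) - snd l)" for n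
      using K[OF subspace_diff[OF H(1) zH lH]] by simp
    have "(\<lambda>n. K * norm (snd (z n) - snd l)) \<longlonglongrightarrow> 0"
      using tendsto_mult_right_zero[OF tendsto_norm_zero[OF LIM_zero[OF lim(2)]]] .
    then have "(\<lambda>n. T (snd (z n)) - T (snd l)) \<longlonglongrightarrow> 0"
      by (rule Lim_null_comparison[rotated]) (simp add: le)
    then have "(\<lambda>n. T (snd (z n))) \<longlonglongrightarrow> T (snd l)" by (rule LIM_zero_cancel)
    moreover have "(\<lambda>n. T (snd (z n))) \<longlonglongrightarrow> q (fst l)"
      using q.tendsto[OF lim(1)] by (simp add: qz)
    ultimately have "q (fst l) = T (snd l)" using LIMSEQ_unique by blast
    then show "l \<in> P" using lH by (simp add: P_def split_beta)
  qed

  \<comment> \<open>A closed separable part \<open>Z\<close> of the pull-back that still maps onto \<open>H\<close>.\<close>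
  obtain B where B: "countable B" "B \<subseteq> H" "H \<subseteq> closure B"
    by (rule countable_dense_subset_of_subset[OF D])
  obtain l where l: "\<And>y. q (l y) = y" "\<And>y. norm (l y) \<le> Cq * norm y"
    using Cq(2) by metis
  obtain W where W: "countable W" "(\<lambda>h. (l (T h), h)) ` B \<subseteq> W"
      "W \<subseteq> span ((\<lambda>h. (l (T h), h)) ` B)" "subspace (closure W)"
    by (rule countable_dense_subset_of_span[OF countable_image[OF B(1)]])
  define Z where "Z = closure W"
  have Z: "subspace Z" "closed Z" using W(4) by (auto simp: Z_def)
  have "(\<lambda>h. (l (T h), h)) ` B \<subseteq> P" using B(2) l(1) by (auto simp: P_def)
  then have "W \<subseteq> P" using W(3) span_minimal[OF _ P] by blast
  then have ZP: "Z \<subseteq> P" unfolding Z_def using \<open>closed P\<close> by (rule closure_minimal)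
  then have q_Z: "q e = T h" if "(e, h) \<in> Z" for e h
    using that by (auto simp: P_def)
  have snd_Z: "snd ` Z \<subseteq> H" using ZP by (auto simp: P_def)

  have "Z \<subseteq> UNIV \<times> H" using snd_Z by auto
  then have Z_complete: "complete Z"
    using complete_Int_closed[OF complete_UNIV_Times[OF H(2)] Z(2)] by (simp add: Int_absorb1)
  define C where "C = 2 * (Cq * \<bar>K\<bar> + 1)"
  have approx: "\<exists>z\<in>Z. norm z \<le> C * norm h \<and> norm (h - snd z) < \<epsilon>" if h: "h \<in> H" and "\<epsilon> > 0" for h \<epsilon>
  proof (cases "h = 0")
    case True
    then show ?thesis using \<open>\<epsilon> > 0\<close> subspace_0[OF Z(1)] by (intro bexI[of _ 0]) auto
  next
    case False
    \<comment> \<open>Approximating within \<open>norm h\<close> as well keeps the norm of the approximant below \<open>2 * norm h\<close>.\<close>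
    then have "min \<epsilon> (norm h) > 0" using \<open>\<epsilon> > 0\<close> by simp
    then obtain b where b: "b \<in> B" "dist b h < min \<epsilon> (norm h)"
      using h B(3) by (meson closure_approachable subsetD)
    have "norm b \<le> 2 * norm h"
      using norm_triangle_ineq[of "b - h" h] b(2) by (simp add: dist_norm)
    have "norm (l (T b)) \<le> Cq * norm (T b)" by (rule l(2))
    also have "\<dots> \<le> Cq * (\<bar>K\<bar> * norm b)"
      using K[of b] b(1) B(2) Cq(1) mult_right_mono[OF abs_ge_self[of K], of "norm b"]
      by (intro mult_left_mono) auto
    finally have "norm (l (T b), b) \<le> Cq * (\<bar>K\<bar> * norm b) + norm b"
      using norm_Pair_le[of "l (T b)" b] by linarith
    also have "\<dots> = (Cq * \<bar>K\<bar> + 1) * norm b" by (simp add: algebra_simps)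
    also have "\<dots> \<le> (Cq * \<bar>K\<bar> + 1) * (2 * norm h)"
      using Cq(1) \<open>norm b \<le> 2 * norm h\<close> by (intro mult_left_mono) auto
    finally have "norm (l (T b), b) \<le> C * norm h" by (simp add: C_def mult.commute mult.left_commute)
    moreover have "(l (T b), b) \<in> Z" using W(2) b(1) closure_subset by (auto simp: Z_def)
    moreover have "norm (h - b) < \<epsilon>" using b(2) by (simp add: dist_norm norm_minus_commute)
    ultimately show ?thesis by (intro bexI[of _ "(l (T b), b)"]) auto
  qed
  have "\<exists>e. (e, h) \<in> Z \<and> norm e \<le> 2 * C * norm h" if h: "h \<in> H" for h
  proof -
    obtain z where "z \<in> Z" "snd z = h" "norm z \<le> 2 * C * norm h"
      using exact_lift_from_approximate_lift[OF bounded_linear_snd Z(1) Z_complete H(1) snd_Z approx h] by blast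
    then show ?thesis using norm_fst_le[of "fst z" "snd z"] by (intro exI[of _ "fst z"]) auto
  qed
  then obtain g where g: "\<And>h. h \<in> H \<Longrightarrow> (g h, h) \<in> Z" "\<And>h. h \<in> H \<Longrightarrow> norm (g h) \<le> 2 * C * norm h"
    by metis

  \<comment> \<open>The kernel of \<open>Z \<rightarrow> H\<close> sits inside \<open>range i\<close>, so \<open>i\<close> can be inverted on it; the inverse
    is bounded by the open mapping theorem.\<close>
  define N where "N = Z \<inter> snd -` {0}"
  have N: "closed_subspace (class_structure Z) N"
    unfolding closed_subspace_class_structure[OF Z]
  proof (intro conjI)
    show "subspace N"
      using Z(1) by (auto simp: N_def subspace_def)
    show "closed N"
      unfolding N_def by (intro closed_Int Z closed_vimage closed_singleton continuous_intros)
  qed (auto simp: N_def)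
  define \<phi> where "\<phi> z = inv i (fst z)" for z :: "'e \<times> 'x"
  have i_inv: "i (inv i e) = e" if "e \<in> range i" for e using that by (simp add: f_inv_into_f)
  have "inj i" using i_inj by (simp add: i.linear_axioms linear_injective_0)
  then have inv_i: "inv i (i s) = s" for s by simp
  have N_ker: "fst z \<in> range i" if "z \<in> N" for z
  proof -
    have "z \<in> Z" "snd z = 0" using that by (auto simp: N_def)
    then have "q (fst z) = T 0" using q_Z[of "fst z" "snd z"] by (metis prod.collapse)
    then show ?thesis by (simp add: T_0 flip: ker_q)
  qed
  have "bounded_operator_on (class_structure Z) N \<phi>"
    unfolding bounded_operator_on_class_structure
  proof (intro conjI ballI allI exI)
    fix x y assume "x \<in> N" "y \<in> N"
    then obtain a b where "fst x = i a" "fst y = i b" using N_ker by blast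
    then show "\<phi> (x + y) = \<phi> x + \<phi> y" by (simp add: \<phi>_def inv_i flip: i.add)
  next
    fix c x assume "x \<in> N"
    then obtain a where "fst x = i a" using N_ker by blast
    then show "\<phi> (c *\<^sub>R x) = c *\<^sub>R \<phi> x" by (simp add: \<phi>_def inv_i flip: i.scaleR)
  next
    fix x assume "x \<in> N"
    then obtain a where a: "i a = fst x" "norm a \<le> Ci * norm (fst x)" using N_ker Ci(2) by blast
    then have "norm (\<phi> x) \<le> Ci * norm (fst x)" by (simp add: \<phi>_def inv_i flip: a(1))
    also have "\<dots> \<le> Ci * norm x"
      using Ci(1) norm_fst_le[of "fst x" "snd x"] by simp
    finally show "norm (\<phi> x) \<le> Ci * norm x" .
  qed
  moreover have "operators_extend (class_structure Z) TYPE('s)"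
  proof (rule separably_injective_extend[OF S])
    show "is_banach_space (class_structure Z)"
      by (rule is_banach_space_class_structure[OF Z(1) Z_complete])
    have "top_of_set Z closure_of W = Z"
      using closure_subset[of W] by (simp add: closure_of_subtopology Z_def Int_absorb1)
    then show "separable_space (normed_topology (class_structure Z))"
      unfolding normed_topology_class_structure[OF Z(1)] separable_space_def
      using W(1) closure_subset[of W] by (auto simp: Z_def)
  qed
  ultimately obtain M where M: "bounded_operator_on (class_structure Z) Z M" "\<And>z. z \<in> N \<Longrightarrow> M z = \<phi> z"
    using N unfolding operators_extend_def points_class_structure
    by (elim allE[of _ N] allE[of _ \<phi>]) blast
  then obtain L where M_add: "\<And>x y. x \<in> Z \<Longrightarrow> y \<in> Z \<Longrightarrow> M (x + y) = M x + M y"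
    and M_scale: "\<And>c x. x \<in> Z \<Longrightarrow> M (c *\<^sub>R x) = c *\<^sub>R M x"
    and L: "\<And>x. x \<in> Z \<Longrightarrow> norm (M x) \<le> L * norm x"
    unfolding bounded_operator_on_class_structure by blast

  \<comment> \<open>Subtracting the extension leaves the composite with \<open>q\<close> unchanged and kills \<open>N\<close>.\<close>
  define \<psi> where "\<psi> z = fst z - i (M z)" for z
  have \<psi>_add: "\<psi> (x + y) = \<psi> x + \<psi> y" if "x \<in> Z" "y \<in> Z" for x y
    using that by (simp add: \<psi>_def M_add i.add)
  have \<psi>_scale: "\<psi> (c *\<^sub>R x) = c *\<^sub>R \<psi> x" if "x \<in> Z" for c x
    using that by (simp add: \<psi>_def M_scale i.scaleR scaleR_diff_right)
  have \<psi>_eq: "\<psi> x = \<psi> y" if "x \<in> Z" "y \<in> Z" "snd x = snd y" for x y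
  proof -
    have "x - y \<in> N" using that Z(1) by (simp add: N_def subspace_diff)
    then have "\<psi> (x - y) = 0" using M(2) i_inv[OF N_ker] by (simp only: \<psi>_def \<phi>_def) simp
    then show ?thesis using \<psi>_add[of "x - y" y] that Z(1) by (simp add: subspace_diff)
  qed
  define \<tau> where "\<tau> h = \<psi> (g h, h)" for h
  obtain Ki where Ki: "Ki > 0" "\<And>s. norm (i s) \<le> norm s * Ki" using i.pos_bounded by blast
  have "bounded_operator_on (class_structure V) H \<tau>"
    unfolding bounded_operator_on_class_structure
  proof (intro conjI ballI allI exI)
    fix x y assume xy: "x \<in> H" "y \<in> H"
    then have "\<tau> (x + y) = \<psi> ((g x, x) + (g y, y))"
      unfolding \<tau>_def using H(1) Z(1) g(1) by (intro \<psi>_eq subspace_add) (auto intro: subspace_add)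
    then show "\<tau> (x + y) = \<tau> x + \<tau> y" using xy g(1) by (simp only: \<psi>_add \<tau>_def)
  next
    fix c x assume x: "x \<in> H"
    then have "\<tau> (c *\<^sub>R x) = \<psi> (c *\<^sub>R (g x, x))"
      unfolding \<tau>_def using H(1) Z(1) g(1) by (intro \<psi>_eq subspace_scale) (auto intro: subspace_scale)
    then show "\<tau> (c *\<^sub>R x) = c *\<^sub>R \<tau> x" using x g(1) by (simp only: \<psi>_scale \<tau>_def)
  next
    fix h assume h: "h \<in> H"
    have pair: "norm (g h, h) \<le> (2 * C + 1) * norm h"
      using norm_Pair_le[of "g h" h] g(2)[OF h] by (simp add: distrib_right)
    have "norm (M (g h, h)) \<le> \<bar>L\<bar> * norm (g h, h)"
      using L[OF g(1)[OF h]] mult_right_mono[OF abs_ge_self[of L], of "norm (g h, h)"] by simp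
    also have "\<dots> \<le> \<bar>L\<bar> * ((2 * C + 1) * norm h)"
      using pair by (intro mult_left_mono) auto
    finally have "norm (M (g h, h)) * Ki \<le> \<bar>L\<bar> * ((2 * C + 1) * norm h) * Ki"
      using Ki(1) by (intro mult_right_mono) auto
    then have "norm (i (M (g h, h))) \<le> \<bar>L\<bar> * ((2 * C + 1) * norm h) * Ki"
      using Ki(2) order_trans by blast
    then have "norm (\<tau> h) \<le> 2 * C * norm h + \<bar>L\<bar> * ((2 * C + 1) * norm h) * Ki"
      using norm_triangle_ineq4[of "g h" "i (M (g h, h))"] g(2)[OF h]
      by (simp add: \<tau>_def \<psi>_def)
    then show "norm (\<tau> h) \<le> (2 * C + \<bar>L\<bar> * (2 * C + 1) * Ki) * norm h"
      by (simp add: algebra_simps)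
  qed
  moreover have "q (\<tau> h) = T h" if "h \<in> H" for h
    using q_Z[OF g(1)[OF that]] by (simp add: \<tau>_def \<psi>_def q.diff qi)
  ultimately show thesis by (rule that)
qed

theorem proposition4p2:
  fixes i :: "'s::banach \<Rightarrow> 'e::banach" and q :: "'e \<Rightarrow> 'q::banach"
  assumes "short_exact_sequence i q"
    and "LP_space TYPE('e)"
    and "separably_injective TYPE('s)"
  shows "LP_space TYPE('q)"
  unfolding LP_space_def operators_extend_def
proof (intro allI impI, elim conjE)
  fix Y and T :: "(nat \<Rightarrow>\<^sub>C real) \<Rightarrow> 'q"
  let ?V = "{x :: nat \<Rightarrow>\<^sub>C real. apply_bcontfun x \<longlonglongrightarrow> 0}"
  assume Y: "closed_subspace c0 Y" and T: "bounded_operator_on c0 Y T"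
  have V: "subspace ?V" "complete ?V"
    using is_banach_space_class_structureD[OF is_banach_space_c0[unfolded c0_def]] .
  have Y': "Y \<subseteq> ?V" "subspace Y" "closed Y"
    using Y unfolding c0_def
    by (simp_all add: closed_subspace_class_structure[OF V(1) complete_imp_closed[OF V(2)]])
  have Yc: "complete Y"
    using complete_Int_closed[OF V(2) Y'(3)] Y'(1) by (simp add: Int_absorb1)
  obtain D :: "(nat \<Rightarrow>\<^sub>C real) set" where D: "countable D" "points c0 \<subseteq> closure D"
    by (rule c0_separable)
  then have "Y \<subseteq> closure D" using Y'(1) by (auto simp: points_c0)
  from lift_operator_from_separable_subspace[OF assms(1,3) Y'(2) Yc D(1) this T[unfolded c0_def]]
  obtain \<tau> where \<tau>: "bounded_operator_on c0 Y \<tau>" "\<And>h. h \<in> Y \<Longrightarrow> q (\<tau> h) = T h"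
    unfolding c0_def by blast
  then obtain \<tau>' where \<tau>': "bounded_operator_on c0 (points c0) \<tau>'" "\<forall>y\<in>Y. \<tau>' y = \<tau> y"
    using assms(2) Y unfolding LP_space_def operators_extend_def by blast
  interpret q: bounded_linear q using assms(1) by (simp add: short_exact_sequence_def)
  have \<tau>'_add: "\<And>x y. x \<in> ?V \<Longrightarrow> y \<in> ?V \<Longrightarrow> \<tau>' (x + y) = \<tau>' x + \<tau>' y"
    and \<tau>'_scale: "\<And>c x. x \<in> ?V \<Longrightarrow> \<tau>' (c *\<^sub>R x) = c *\<^sub>R \<tau>' x"
    and "\<exists>K. \<forall>x\<in>?V. norm (\<tau>' x) \<le> K * norm x"
    using \<tau>'(1) unfolding c0_def bounded_operator_on_class_structure
    by (simp_all add: class_structure_def)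
  then obtain K where K: "\<And>x. x \<in> ?V \<Longrightarrow> norm (\<tau>' x) \<le> K * norm x" by blast
  obtain Kq where Kq: "Kq > 0" "\<And>e. norm (q e) \<le> norm e * Kq" using q.pos_bounded by blast
  have "norm (q (\<tau>' x)) \<le> (K * Kq) * norm x" if "x \<in> ?V" for x
    using order_trans[OF Kq(2) mult_right_mono[OF K[OF that], of Kq]] Kq(1)
    by (simp add: mult_ac)
  then have "bounded_operator_on c0 ?V (\<lambda>x. q (\<tau>' x))"
    unfolding c0_def bounded_operator_on_class_structure
    by (auto simp: \<tau>'_add \<tau>'_scale q.add q.scaleR)
  then show "\<exists>T'. bounded_operator_on c0 (points c0) T' \<and> (\<forall>y\<in>Y. T' y = T y)"
  proof (intro exI[of _ "\<lambda>x. q (\<tau>' x)"] conjI ballI)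
    show "bounded_operator_on c0 (points c0) (\<lambda>x. q (\<tau>' x))"
      using \<open>bounded_operator_on c0 ?V _\<close> by (simp add: points_c0)
    show "q (\<tau>' y) = T y" if "y \<in> Y" for y
      using \<tau>(2)[OF that] \<tau>'(2) that by simp
  qed
qed

end
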